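(* Let $F$ be a field. The group of units $U(F)=F\setminus\{0\}$ of $F$ is a proper union of subsemigroups if and only if $F$ is not an algebraic extension of a finite field.
   Context: A set $S$ is said to be the proper union of the sets $S_1,\ldots,S_n$ ($n\ge 2$ a finite integer) if $\bigcup_{i=1}^n S_i=S$ and $\bigcup_{i\neq k}S_i\neq S$ for every $k=1,\ldots,n$. "$U(F)$ is a proper union of subsemigroups" means that there are $n\ge 2$ and subsemigroups (subsets closed under multiplication) $S_1,\ldots,S_n$ of the multiplicative group $U(F)$ such that $U(F)$ is the proper union of $S_1,\ldots,S_n$. A finite field counts as an algebraic extension of itself. *)

theory Defs
  imports "HOL-Algebra.Algebra"
begin

text \<open>Subsemigroups are not required to be nonempty; the empty set can never be a member of a
  proper union.\<close>

definition subsemigroup :: "'a set \<Rightarrow> ('a, 'b) monoid_scheme \<Rightarrow> bool"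
  where "subsemigroup H G \<longleftrightarrow> H \<subseteq> carrier G \<and> (\<forall>x\<in>H. \<forall>y\<in>H. x \<otimes>\<^bsub>G\<^esub> y \<in> H)"

definition proper_union :: "'a set \<Rightarrow> nat \<Rightarrow> (nat \<Rightarrow> 'a set) \<Rightarrow> bool"
  where "proper_union S n T \<longleftrightarrow>
    n \<ge> 2 \<and> (\<Union>i\<in>{1..n}. T i) = S \<and> (\<forall>k\<in>{1..n}. (\<Union>i\<in>{1..n} - {k}. T i) \<noteq> S)"

definition proper_union_of_subsemigroups :: "('a, 'b) monoid_scheme \<Rightarrow> bool"
  where "proper_union_of_subsemigroups G \<longleftrightarrow>
    (\<exists>n T. proper_union (carrier G) n T \<and> (\<forall>i\<in>{1..n}. subsemigroup (T i) G))"

definition algebraic_extension :: "('a, 'b) ring_scheme \<Rightarrow> 'a set \<Rightarrow> bool"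
  where "algebraic_extension L K \<longleftrightarrow>
    field L \<and> subfield K L \<and> (\<forall>x\<in>carrier L. (ring.algebraic L over K) x)"

end

theory Submission
  imports Defs
begin

text \<open>
  The group of units of a field \<open>F\<close> has an element of infinite order exactly when \<open>F\<close> is not algebraic
  over a finite field, and the two directions use this dichotomy as follows.

  An abelian group \<open>G\<close> with an element \<open>a\<close> of infinite order is covered by two half-spaces. Zorn's
  lemma yields a submonoid \<open>S\<close> that is maximal among those containing \<open>a\<close> but not \<open>inv a\<close>; such an
  \<open>S\<close> contains \<open>x\<close> or \<open>inv x\<close> for every \<open>x\<close> (lemma \<open>maximal_submonoid_total\<close>), as the nonnegative cone
  of a total preorder does. Hence \<open>G\<close> is the union of \<open>S\<close> and the set of inverses of \<open>S\<close>, and neither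
  is all of \<open>G\<close>, because \<open>inv a\<close> is missing from the first and \<open>a\<close> from the second.

  Such an \<open>a\<close> exists among the units unless \<open>F\<close> is algebraic over a finite field: if all units are
  roots of unity, then 2 is zero or a root of unity, so the characteristic is positive, the multiples of
  1 form a finite subring, this subring is a field because the inverse of a root of unity is one of its
  powers, and roots of unity are algebraic over it
  (lemma \<open>algebraic_over_finite_if_units_torsion\<close>).

  Conversely, let \<open>F\<close> be algebraic over a finite subfield. Finitely many units lie in a finite subfield,
  whose unit group is cyclic, so they are positive powers of a single unit \<open>g\<close>
  (lemma \<open>finite_subset_monogenic_if_algebraic_over_finite\<close>). In a proper union each member has an
  element \<open>x k\<close> of its own; but the member containing the common root \<open>g\<close> of the \<open>x k\<close> contains all of
  them, which is absurd for two or more members.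
\<close>

section \<open>Groups with an element of infinite order\<close>

text \<open>
  If neither \<open>x\<close> nor \<open>inv x\<close> is in \<open>S\<close>, then adjoining either of them must by maximality produce
  \<open>inv a\<close>, say \<open>inv a = s \<otimes> x [^] m\<close> and \<open>inv a = t \<otimes> inv x [^] n\<close>. Raising the first equation to the
  power \<open>n\<close> and the second to the power \<open>m\<close> and multiplying cancels \<open>x\<close>, which puts a power of \<open>inv a\<close>,
  and then \<open>inv a\<close> itself, into \<open>S\<close>.
\<close>

lemma (in comm_group) maximal_submonoid_total:
  assumes S: "submonoid S G" and a: "a \<in> S" "inv a \<notin> S"
    and max: "\<And>T. submonoid T G \<Longrightarrow> S \<subseteq> T \<Longrightarrow> inv a \<notin> T \<Longrightarrow> T = S"
    and x: "x \<in> carrier G"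
  shows "x \<in> S \<or> inv x \<in> S"
proof (rule ccontr)
  interpret S: submonoid S G by (rule S)
  have pow_S: "s [^] (n::nat) \<in> S" if "s \<in> S" for s n
    using that by (induction n) auto
  have adjoin: "\<exists>s\<in>S. \<exists>n::nat. inv a = s \<otimes> y [^] n" if y: "y \<in> carrier G" "y \<notin> S" for y
  proof (rule ccontr)
    let ?T = "{s \<otimes> y [^] n | s n. s \<in> S \<and> n \<in> (UNIV :: nat set)}"
    assume no: "\<not> (\<exists>s\<in>S. \<exists>n::nat. inv a = s \<otimes> y [^] n)"
    have "submonoid ?T G"
    proof (rule submonoid.intro)
      show "?T \<subseteq> carrier G"
        using y S.subset by auto
    next
      fix u v assume "u \<in> ?T" "v \<in> ?T"
      then obtain s m t n where
        st: "s \<in> S" "t \<in> S" "u = s \<otimes> y [^] (m::nat)" "v = t \<otimes> y [^] (n::nat)"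
        by auto
      then have "u \<otimes> v = (s \<otimes> t) \<otimes> (y [^] m \<otimes> y [^] n)"
        using y S.subset by (simp add: m_ac subset_iff)
      also have "\<dots> = (s \<otimes> t) \<otimes> y [^] (m + n)"
        using y by (simp add: nat_pow_mult)
      finally show "u \<otimes> v \<in> ?T"
        using st by blast
    next
      have "\<one> = \<one> \<otimes> y [^] (0::nat)" by simp
      then show "\<one> \<in> ?T"
        using S.one_closed by blast
    qed
    moreover have "S \<subseteq> ?T"
    proof
      fix s assume "s \<in> S"
      moreover have "s = s \<otimes> y [^] (0::nat)"
        using \<open>s \<in> S\<close> S.subset by auto
      ultimately show "s \<in> ?T" by blast
    qed
    moreover have "inv a \<notin> ?T"
      using no by auto
    ultimately have "?T = S" by (rule max)
    moreover have "y = \<one> \<otimes> y [^] (1::nat)"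
      using y by simp
    ultimately show False
      using y(2) S.one_closed by blast
  qed
  assume "\<not> (x \<in> S \<or> inv x \<in> S)"
  then obtain s t m n where st: "s \<in> S" "t \<in> S"
    and eq: "inv a = s \<otimes> x [^] (m::nat)" "inv a = t \<otimes> inv x [^] (n::nat)"
    using adjoin[of x] adjoin[of "inv x"] x by auto
  note carr [simp] = S.mem_carrier[OF st(1)] S.mem_carrier[OF st(2)] S.mem_carrier[OF a(1)] x
  \<comment> \<open>A positive \<open>m\<close> ensures \<open>m + n - 1 \<ge> 0\<close>, so that \<open>a [^] (m + n - 1)\<close> lies in \<open>S\<close>; multiplying
    \<open>inv a [^] (m + n)\<close> by it leaves \<open>inv a\<close>.\<close>
  have "m \<noteq> 0"
    using eq(1) st a by (metis r_one nat_pow_0 carr(1))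
  then obtain k where k: "m = Suc k" by (cases m) auto
  have "inv a [^] (m + n) = inv a [^] n \<otimes> inv a [^] m"
    by (simp add: nat_pow_mult add.commute)
  also have "\<dots> = (s \<otimes> x [^] m) [^] n \<otimes> (t \<otimes> inv x [^] n) [^] m"
    using eq by simp
  also have "\<dots> = (s [^] n \<otimes> t [^] m) \<otimes> (x [^] (m * n) \<otimes> inv x [^] (m * n))"
    by (simp add: nat_pow_distrib nat_pow_pow m_ac mult.commute)
  also have "\<dots> = s [^] n \<otimes> t [^] m"
    by (simp add: nat_pow_inv)
  finally have "inv a [^] (m + n) \<in> S"
    using pow_S st by simp
  then have "inv a [^] (m + n) \<otimes> a [^] (k + n) \<in> S"
    using pow_S a(1) by blast
  moreover have "inv a [^] (m + n) \<otimes> a [^] (k + n) = inv a"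
  proof -
    have "inv a [^] (m + n) \<otimes> a [^] (k + n) = (inv a \<otimes> inv a [^] (k + n)) \<otimes> a [^] (k + n)"
      by (simp add: k m_comm)
    also have "\<dots> = inv a \<otimes> (inv (a [^] (k + n)) \<otimes> a [^] (k + n))"
      by (simp add: nat_pow_inv m_assoc)
    finally show ?thesis by simp
  qed
  ultimately show False
    using a(2) by simp
qed

lemma (in comm_group) proper_union_of_subsemigroups_if_infinite_order:
  assumes a: "a \<in> carrier G" and inf: "\<And>n::nat. n > 0 \<Longrightarrow> a [^] n \<noteq> \<one>"
  shows "proper_union_of_subsemigroups G"
proof -
  let ?A = "{S. submonoid S G \<and> a \<in> S \<and> inv a \<notin> S}"
  let ?P = "range (\<lambda>n::nat. a [^] n)"
  \<comment> \<open>Infinite order is what keeps \<open>inv a\<close> out of the powers of \<open>a\<close>, the starting point for Zorn's lemma.\<close>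
  have "?A \<noteq> {}"
  proof -
    have "submonoid ?P G"
    proof (rule submonoid.intro)
      show "\<one> \<in> ?P"
        by (rule range_eqI[of _ _ 0]) simp
    qed (use a in \<open>auto simp: nat_pow_mult\<close>)
    moreover have "a \<in> ?P"
      by (rule range_eqI[of _ _ 1]) (use a in simp)
    moreover have "inv a \<notin> ?P"
    proof
      assume "inv a \<in> ?P"
      then obtain n :: nat where "inv a = a [^] n" by auto
      then have "a [^] Suc n = \<one>"
        using a by (metis l_inv nat_pow_Suc)
      then show False
        using inf[of "Suc n"] by simp
    qed
    ultimately show ?thesis by blast
  qed
  moreover have "\<Union>\<C> \<in> ?A" if ne: "\<C> \<noteq> {}" and ch: "subset.chain ?A \<C>" for \<C>
  proof -
    from ch have mem: "\<And>S. S \<in> \<C> \<Longrightarrow> S \<in> ?A"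
      and lin: "\<And>S T. S \<in> \<C> \<Longrightarrow> T \<in> \<C> \<Longrightarrow> S \<subseteq> T \<or> T \<subseteq> S"
      unfolding subset_chain_def by auto
    have "submonoid (\<Union>\<C>) G"
    proof (rule submonoid.intro)
      show "\<Union>\<C> \<subseteq> carrier G"
        using mem submonoid.subset by blast
    next
      fix x y assume "x \<in> \<Union>\<C>" "y \<in> \<Union>\<C>"
      then obtain V W where VW: "V \<in> \<C>" "x \<in> V" "W \<in> \<C>" "y \<in> W"
        by blast
      obtain S where "S \<in> \<C>" "x \<in> S" "y \<in> S"
        using lin[OF VW(1,3)] VW by auto
      then have "x \<otimes> y \<in> S"
        using mem[of S] by (simp add: submonoid.m_closed)
      then show "x \<otimes> y \<in> \<Union>\<C>"
        using \<open>S \<in> \<C>\<close> by blast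
    next
      obtain S where "S \<in> \<C>"
        using ne by blast
      moreover have "\<one> \<in> S"
        using mem[OF \<open>S \<in> \<C>\<close>] by (simp add: submonoid.one_closed)
      ultimately show "\<one> \<in> \<Union>\<C>"
        by blast
    qed
    then show ?thesis
      using ne mem by auto
  qed
  ultimately have "\<exists>S\<in>?A. \<forall>T\<in>?A. S \<subseteq> T \<longrightarrow> T = S"
    by (rule subset_Zorn_nonempty)
  then obtain S where S: "submonoid S G" "a \<in> S" "inv a \<notin> S"
    and max: "\<And>T. T \<in> ?A \<Longrightarrow> S \<subseteq> T \<Longrightarrow> T = S"
    by auto
  interpret S: submonoid S G by (rule S)
  have total: "x \<in> S \<or> inv x \<in> S" if "x \<in> carrier G" for x
    using maximal_submonoid_total[OF S _ that] max S(2) by blast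
  define S' where "S' = {x \<in> carrier G. inv x \<in> S}"
  define T where "T i = (if i = (1::nat) then S else S')" for i
  have "subsemigroup S G" "subsemigroup S' G"
    using S.subset by (auto simp: subsemigroup_def S'_def inv_mult)
  moreover have "S' \<union> S = carrier G"
    using total S.subset by (auto simp: S'_def)
  moreover have "S \<noteq> carrier G"
    using S(3) a by (metis inv_closed)
  moreover have "a \<notin> S'"
    using S(3) by (simp add: S'_def)
  then have "S' \<noteq> carrier G"
    using a by blast
  moreover have "{1..2} = {1, 2::nat}" by auto
  moreover have "{1, 2} - {1} = {2::nat}" "{1, 2} - {2} = {1::nat}" by auto
  ultimately have "proper_union (carrier G) 2 T \<and> (\<forall>i\<in>{1..2}. subsemigroup (T i) G)"
    by (simp add: proper_union_def T_def)
  then show ?thesis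
    unfolding proper_union_of_subsemigroups_def by blast
qed

section \<open>Groups whose finite subsets consist of powers of one element\<close>

lemma (in monoid) subsemigroup_nat_pow_closed:
  assumes H: "subsemigroup H G" and "g \<in> H" and "n > 0"
  shows "g [^] (n::nat) \<in> H"
  using \<open>n > 0\<close>
proof (induction n rule: nat_induct_non_zero)
  case 1
  then show ?case using assms by (auto simp: subsemigroup_def)
next
  case (Suc n)
  then show ?case using assms by (auto simp: subsemigroup_def)
qed

text \<open>
  Choose for each member an element that no other member contains, and let \<open>g\<close> be a common root of
  the chosen elements. The exponents must be positive because a subsemigroup containing \<open>g\<close> need not
  contain \<open>\<one>\<close>.
\<close>

lemma (in monoid) not_proper_union_of_subsemigroups_if_finite_subsets_monogenic:
  assumes gen: "\<And>A. finite A \<Longrightarrow> A \<subseteq> carrier G \<Longrightarrow>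
    \<exists>g\<in>carrier G. \<forall>x\<in>A. \<exists>m>0. x = g [^] (m::nat)"
  shows "\<not> proper_union_of_subsemigroups G"
proof
  assume "proper_union_of_subsemigroups G"
  then obtain n T where "proper_union (carrier G) n T" "\<forall>i\<in>{1..n}. subsemigroup (T i) G"
    unfolding proper_union_of_subsemigroups_def by (elim exE conjE)
  then have n: "n \<ge> 2" and U: "(\<Union>i\<in>{1..n}. T i) = carrier G"
    and irredundant: "\<And>k. k \<in> {1..n} \<Longrightarrow> (\<Union>i\<in>{1..n} - {k}. T i) \<noteq> carrier G"
    and sub: "\<And>i. i \<in> {1..n} \<Longrightarrow> subsemigroup (T i) G"
    by (simp_all add: proper_union_def)
  have "\<exists>x. x \<in> carrier G \<and> (\<forall>i\<in>{1..n} - {k}. x \<notin> T i)" if "k \<in> {1..n}" for k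
    using irredundant[OF that] U by blast
  then obtain x where x: "\<And>k. k \<in> {1..n} \<Longrightarrow> x k \<in> carrier G"
      "\<And>k i. k \<in> {1..n} \<Longrightarrow> i \<in> {1..n} - {k} \<Longrightarrow> x k \<notin> T i"
    by metis
  have "x ` {1..n} \<subseteq> carrier G"
    using x(1) by blast
  then have "\<exists>g\<in>carrier G. \<forall>y\<in>x ` {1..n}. \<exists>m>0. y = g [^] (m::nat)"
    by (intro gen) simp
  then obtain g where g: "g \<in> carrier G"
    and pow: "\<And>k. k \<in> {1..n} \<Longrightarrow> \<exists>m>0. x k = g [^] (m::nat)"
    by blast
  obtain j where j: "j \<in> {1..n}" "g \<in> T j"
    using g U by blast
  obtain k where k: "k \<in> {1..n}" "k \<noteq> j"
    using that[of "if j = 1 then 2 else 1"] n by auto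
  have "x k \<in> T j"
    using pow[OF k(1)] subsemigroup_nat_pow_closed[OF sub[OF j(1)] j(2)] by auto
  then show False
    using x(2)[OF k(1), of j] j(1) k(2) by simp
qed

section \<open>Algebraic extensions of finite fields\<close>

lemma (in ring) finite_if_dimension_over_finite:
  assumes "finite K" and "dimension n K E"
  shows "finite E"
  using assms(2,1)
proof (induction rule: dimension.induct)
  case zero_dim
  then show ?case by simp
next
  case (Suc_dim v E n K)
  have "line_extension K v E = (\<lambda>(k, u). k \<otimes> v \<oplus> u) ` (K \<times> E)"
    by (force simp: line_extension_mem_iff)
  then show ?case
    using Suc_dim by simp
qed

text \<open>
  The extension generated by the finite set has finite dimension over \<open>K\<close>, so it is a finite field and
  its unit group is cyclic.
\<close>

lemma (in field) finite_subset_monogenic_if_algebraic_over_finite: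
  assumes K: "subfield K R" "finite K" and alg: "\<And>x. x \<in> carrier R \<Longrightarrow> (algebraic over K) x"
    and A: "finite A" "A \<subseteq> Units R"
  shows "\<exists>g\<in>Units R. \<forall>x\<in>A. \<exists>m>0. x = g [^] (m::nat)"
proof -
  obtain xs where xs: "set xs = A"
    using finite_list[OF A(1)] by blast
  have xs_carr: "set xs \<subseteq> carrier R"
    using xs A(2) by auto
  define L where "L = finite_extension K xs"
  let ?L = "R\<lparr>carrier := L\<rparr>"
  have L: "subfield L R"
    unfolding L_def using finite_extension_is_subfield[OF K(1) xs_carr] alg xs_carr by blast
  have L_carr: "L \<subseteq> carrier R"
    using L by (rule subfieldE)
  have fin: "finite L"
    unfolding L_def
    using finite_extension_finite_dimension(1)[OF K(1) xs_carr] alg xs_carr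
      finite_if_dimension_over_finite[OF K(2)] by blast
  interpret L: field ?L
    using L by (simp add: subfield_iff)
  interpret M: group "units_of ?L"
    by (rule L.units_group)
  have pow: "y [^]\<^bsub>units_of ?L\<^esub> (i::nat) = y [^] i" for y i
    by (simp add: units_of_def nat_pow_def)
  have carr: "carrier (units_of ?L) = L - {\<zero>}"
    by (simp add: units_of_carrier L.field_Units)
  obtain g where g: "g \<in> L - {\<zero>}" "L - {\<zero>} = {g [^] i | i::nat. i \<in> UNIV}"
    using L.finite_field_mult_group_has_gen fin
    by (auto simp: nat_pow_def)
  define N where "N = order (units_of ?L)"
  have N: "N > 0" "g [^] N = \<one>"
    using M.pow_order_eq_1[of g] M.order_gt_0_iff_finite fin g(1)
    by (auto simp: N_def pow carr units_of_one)
  have "\<exists>m>0. x = g [^] (m::nat)" if "x \<in> A" for x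
  proof -
    have "x \<in> L - {\<zero>}"
      using that xs A(2) finite_extension_mem[OF subfieldE(1)[OF K(1)] xs_carr]
      by (auto simp: L_def field_Units)
    then obtain i :: nat where "x = g [^] i"
      using g(2) by auto
    \<comment> \<open>The exponent \<open>i\<close> may be 0; adding the order of the finite unit group makes it positive.\<close>
    then have "x = g [^] (i + N)"
      using g(1) L_carr N(2) by (auto simp flip: nat_pow_mult)
    then show ?thesis
      using N(1) by (metis add_gr_0)
  qed
  moreover have "g \<in> Units R"
    using g(1) L_carr by (auto simp: field_Units)
  ultimately show ?thesis by blast
qed

section \<open>Fields whose units are roots of unity\<close>

lemma (in ring) one_add_pow_mult:
  "(add_pow R m \<one>) \<otimes> (add_pow R n \<one>) = add_pow R (m * n) \<one>" for m n :: nat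
  by (simp add: add_pow_ldistr add.nat_pow_pow mult.commute)

text \<open>
  Either 2 vanishes or it is a root of unity, and \<open>2 ^ n = 1\<close> in the field says that the positive
  integer \<open>2 ^ n - 1\<close> vanishes there.
\<close>

lemma (in field) finite_char_if_units_torsion:
  assumes tor: "\<And>x. x \<in> Units R \<Longrightarrow> \<exists>n>0. x [^] (n::nat) = \<one>"
  shows "\<exists>N>0. add_pow R (N :: nat) \<one> = \<zero>"
proof (cases "add_pow R (2 :: nat) \<one> = \<zero>")
  case True
  then show ?thesis by (intro exI[of _ 2]) simp
next
  case False
  then have "add_pow R (2 :: nat) \<one> \<in> Units R"
    by (simp add: field_Units)
  then obtain n :: nat where n: "n > 0" "(add_pow R (2 :: nat) \<one>) [^] n = \<one>"
    using tor by blast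
  have "(add_pow R (2 :: nat) \<one>) [^] k = add_pow R (2 ^ k :: nat) \<one>" for k :: nat
    by (induction k) (simp_all add: one_add_pow_mult mult.commute)
  then have pow: "add_pow R (2 ^ n :: nat) \<one> = \<one>"
    using n(2) by simp
  have "(2::nat) ^ n = Suc (2 ^ n - 1)" by simp
  then have "add_pow R (2 ^ n - 1 :: nat) \<one> \<oplus> \<one> = \<one>"
    using pow by (metis add.nat_pow_Suc)
  then have "add_pow R (2 ^ n - 1 :: nat) \<one> = \<zero>"
    by (metis add.nat_pow_closed add.l_cancel_one' add.m_comm one_closed)
  moreover have "(2::nat) ^ n - 1 > 0"
    using one_less_power[of "2::nat" n] n(1) by simp
  ultimately show ?thesis by blast
qed

text \<open>
  The subfield is the set of natural multiples of \<open>\<one>\<close>: as \<open>N\<close> times \<open>\<one>\<close> vanishes, it is finite and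
  closed under negation, and as every nonzero element is a root of unity, inverses are powers.
\<close>

lemma (in field) finite_subfield_if_units_torsion:
  assumes tor: "\<And>x. x \<in> Units R \<Longrightarrow> \<exists>n>0. x [^] (n::nat) = \<one>"
  shows "\<exists>K. subfield K R \<and> finite K"
proof -
  obtain N :: nat where N: "N > 0" "add_pow R N \<one> = \<zero>"
    using finite_char_if_units_torsion[OF tor] by blast
  define K where "K = range (\<lambda>n::nat. add_pow R n \<one>)"
  have mod: "add_pow R n \<one> = add_pow R (n mod N) \<one>" for n :: nat
  proof -
    have "add_pow R n \<one> = add_pow R (N * (n div N) + n mod N) \<one>" by simp
    also have "\<dots> = add_pow R (n div N) (add_pow R N \<one>) \<oplus> add_pow R (n mod N) \<one>"
      by (simp only: add.nat_pow_mult[symmetric] add.nat_pow_pow one_closed)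
    also have "\<dots> = add_pow R (n mod N) \<one>"
      by (simp add: N(2))
    finally show ?thesis .
  qed
  have "K \<subseteq> (\<lambda>n. add_pow R n \<one>) ` {..<N}"
  proof
    fix h assume "h \<in> K"
    then obtain n :: nat where "h = add_pow R n \<one>"
      by (auto simp: K_def)
    then have "h = add_pow R (n mod N) \<one>"
      using mod[of n] by metis
    then show "h \<in> (\<lambda>n. add_pow R n \<one>) ` {..<N}"
      using N(1) by simp
  qed
  then have "finite K"
    by (rule finite_subset) simp
  have ring: "subring K R"
  proof (rule subringI)
    show "K \<subseteq> carrier R"
      by (auto simp: K_def)
    show "\<one> \<in> K"
      unfolding K_def by (rule range_eqI[of _ _ 1]) simp
    show "h \<otimes> k \<in> K" if "h \<in> K" "k \<in> K" for h k
      using that by (auto simp: K_def one_add_pow_mult)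
    show "h \<oplus> k \<in> K" if "h \<in> K" "k \<in> K" for h k
      using that by (auto simp: K_def add.nat_pow_mult)
    show "\<ominus> h \<in> K" if hK: "h \<in> K" for h
    proof -
      obtain n :: nat where h: "h = add_pow R n \<one>"
        using hK by (auto simp: K_def)
      have "add_pow R (N - n mod N) \<one> \<oplus> h = add_pow R (N - n mod N + n mod N) \<one>"
        using h mod[of n] by (simp add: add.nat_pow_mult del: le_add_diff_inverse2)
      also have "\<dots> = \<zero>"
        using N by simp
      finally have "\<ominus> h = add_pow R (N - n mod N) \<one>"
        using h by (metis add.nat_pow_closed minus_equality one_closed)
      then show ?thesis
        by (auto simp: K_def)
    qed
  qed
  moreover have "inv k \<in> K" if k: "k \<in> K - {\<zero>}" for k
  proof -
    have k_carr: "k \<in> carrier R"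
      using k by (auto simp: K_def)
    then have "k \<in> Units R"
      using k by (simp add: field_Units)
    then obtain n :: nat where "n > 0" "k [^] n = \<one>"
      using tor by blast
    then obtain m :: nat where m: "k [^] Suc m = \<one>"
      by (metis gr0_implies_Suc)
    then have "inv k = k [^] m"
      using k_carr by (intro comm_inv_char) (simp_all add: m_comm)
    moreover have "k [^] i \<in> K" for i :: nat
      using k subringE(3,6)[OF ring] by (induction i) auto
    ultimately show ?thesis by simp
  qed
  ultimately have "subfield K R"
    by (rule subfieldI')
  with \<open>finite K\<close> show ?thesis by blast
qed

text \<open>
  The distinct monomials of degrees \<open>n\<close> and \<open>0\<close> take the same value at \<open>x\<close>, so evaluation at \<open>x\<close> is
  not injective on polynomials.
\<close>

lemma (in field) root_of_unity_algebraic: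
  assumes K: "subfield K R" and x: "x \<in> carrier R" and n: "n > 0" "x [^] (n::nat) = \<one>"
  shows "(algebraic over K) x"
proof (rule ccontr)
  assume "\<not> (algebraic over K) x"
  then have inj: "inj_on (\<lambda>p. eval p x) (carrier (K[X]))"
    by (simp add: over_def transcendental_def)
  have "monom \<one> k \<in> carrier (K[X])" for k
    using monom_is_polynomial[OF subfieldE(1)[OF K]] subringE(3)[OF subfieldE(1)[OF K]]
    by (simp flip: univ_poly_carrier)
  moreover have "eval (monom \<one> n) x = eval (monom \<one> 0) x"
    using x n(2) by (simp add: eval_monom)
  ultimately have "monom \<one> n = monom \<one> 0"
    using inj by (auto dest: inj_onD)
  then show False
    using n(1) by (simp add: monom_def)
qed

lemma (in field) algebraic_over_finite_if_units_torsion: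
  assumes tor: "\<And>x. x \<in> Units R \<Longrightarrow> \<exists>n>0. x [^] (n::nat) = \<one>"
  shows "\<exists>K. finite K \<and> algebraic_extension R K"
proof -
  obtain K where K: "subfield K R" "finite K"
    using finite_subfield_if_units_torsion[OF tor] by blast
  have "(algebraic over K) x" if x: "x \<in> carrier R" for x
  proof (cases "x = \<zero>")
    case True
    then show ?thesis
      using zero_is_algebraic[OF subfieldE(1)[OF K(1)]] by simp
  next
    case False
    then have "x \<in> Units R"
      using x by (simp add: field_Units)
    then show ?thesis
      using tor root_of_unity_algebraic[OF K(1) x] by blast
  qed
  then show ?thesis
    using K field_axioms by (auto simp: algebraic_extension_def)
qed

section \<open>The characterization\<close>

theorem theorem4:
  fixes F :: "('a, 'b) ring_scheme"
  assumes "field F"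
  shows "proper_union_of_subsemigroups (units_of F) \<longleftrightarrow>
    \<not> (\<exists>K. finite K \<and> algebraic_extension F K)"
proof -
  interpret F: field F by (rule assms)
  interpret U: comm_group "units_of F" by (rule F.units_comm_group)
  have pow: "x [^]\<^bsub>units_of F\<^esub> (n::nat) = x [^]\<^bsub>F\<^esub> n" for x n
    by (simp add: nat_pow_def units_of_def)
  show ?thesis
  proof (intro iffI notI)
    assume union: "proper_union_of_subsemigroups (units_of F)"
      and "\<exists>K. finite K \<and> algebraic_extension F K"
    then obtain K where "finite K" "subfield K F"
      "\<And>x. x \<in> carrier F \<Longrightarrow> (F.algebraic over K) x"
      by (auto simp: algebraic_extension_def)
    then have "\<exists>g\<in>carrier (units_of F). \<forall>x\<in>A. \<exists>m>0. x = g [^]\<^bsub>units_of F\<^esub> (m::nat)"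
      if "finite A" "A \<subseteq> carrier (units_of F)" for A
      using F.finite_subset_monogenic_if_algebraic_over_finite that
      by (simp add: pow units_of_carrier)
    then show False
      using U.not_proper_union_of_subsemigroups_if_finite_subsets_monogenic union by blast
  next
    assume "\<not> (\<exists>K. finite K \<and> algebraic_extension F K)"
    then obtain a where "a \<in> Units F" "\<And>n::nat. n > 0 \<Longrightarrow> a [^]\<^bsub>F\<^esub> n \<noteq> \<one>\<^bsub>F\<^esub>"
      using F.algebraic_over_finite_if_units_torsion by blast
    then show "proper_union_of_subsemigroups (units_of F)"
      by (intro U.proper_union_of_subsemigroups_if_infinite_order[of a])
        (simp_all add: pow units_of_carrier units_of_one)
  qed
qed

end
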